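(* Let $n \ge 5$ be an integer, and let $d(n,5)$ denote the largest minimum weight among all binary linear complementary dual (LCD) $[n,5]$ codes. If $n \equiv 3,5,7,11,19,20,22,26 \pmod{31}$, then \[ d(n,5)=\left\lfloor \frac{16n}{31}\right\rfloor-1 . \] If $n \equiv 4 \pmod{31}$, then \[ d(n,5)=\left\lfloor \frac{16n}{31}\right\rfloor-2 . \]
   Context: A binary $[n,k]$ code $C$ is a $k$-dimensional vector subspace of $\mathbb{F}_2^n$. The weight of a vector is its number of non-zero components, and the minimum weight of $C$ is the minimum weight of its non-zero vectors (codewords). The dual code is $C^\perp=\{x\in\mathbb{F}_2^n \mid x\cdot y=0 \text{ for all } y\in C\}$, where $x\cdot y$ is the standard inner product. The code $C$ is called linear complementary dual (LCD) if $C\cap C^\perp=\{\mathbf{0}_n\}$, where $\mathbf{0}_n$ is the zero vector of length $n$. For $1\le k\le n$, $d(n,k)$ denotes the largest minimum weight among all binary LCD $[n,k]$ codes. *)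

theory Defs
  imports
    "HOL-Library.Z2"
    "Jordan_Normal_Form.VS_Connect"
begin

text \<open>The field with two elements is the type \<^typ>\<open>bit\<close>, and the ambient space of length \<open>n\<close>
  vectors over it is \<open>module_vec TYPE(bit) n\<close>, with carrier \<open>carrier_vec n\<close>.\<close>

definition binary_code :: "nat \<Rightarrow> nat \<Rightarrow> bit vec set \<Rightarrow> bool" where
  "binary_code n k C \<longleftrightarrow>
     VectorSpace.subspace class_ring C (module_vec TYPE(bit) n) \<and>
     vectorspace.dim class_ring ((module_vec TYPE(bit) n)\<lparr>carrier := C\<rparr>) = k"

definition weight :: "bit vec \<Rightarrow> nat" where
  "weight v = card {i. i < dim_vec v \<and> v $ i \<noteq> 0}"

text \<open>Only meaningful for codes with a non-zero codeword, i.e. of dimension at least 1.\<close>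

definition min_weight :: "nat \<Rightarrow> bit vec set \<Rightarrow> nat" where
  "min_weight n C = Min (weight ` (C - {0\<^sub>v n}))"

abbreviation dual_code :: "nat \<Rightarrow> bit vec set \<Rightarrow> bit vec set" where
  "dual_code n C \<equiv> vec_module.orthogonal_complement n C"

lemma dual_code_eq: "dual_code n C = {x \<in> carrier_vec n. \<forall>y\<in>C. x \<bullet> y = 0}"
  by (simp add: vec_module.orthogonal_complement_def)

definition LCD_code :: "nat \<Rightarrow> nat \<Rightarrow> bit vec set \<Rightarrow> bool" where
  "LCD_code n k C \<longleftrightarrow> binary_code n k C \<and> C \<inter> dual_code n C = {0\<^sub>v n}"

text \<open>For \<open>1 \<le> k \<le> n\<close> the maximum is over a finite non-empty set: see
  \<open>finite_LCD_codes\<close> and \<open>LCD_code_exists\<close> below.\<close>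

definition d_LCD :: "nat \<Rightarrow> nat \<Rightarrow> nat" where
  "d_LCD n k = Max (min_weight n ` {C. LCD_code n k C})"

lemma finite_LCD_codes: "finite {C. LCD_code n k C}"
proof -
  have "finite (carrier_vec n :: bit vec set)"
  proof (rule finite_subset)
    show "(carrier_vec n :: bit vec set) \<subseteq> vec_of_list ` {xs. set xs \<subseteq> UNIV \<and> length xs = n}"
    proof
      fix v :: "bit vec" assume "v \<in> carrier_vec n"
      then have "v = vec_of_list (list_of_vec v)" "length (list_of_vec v) = n"
        by (auto simp: vec_list)
      then show "v \<in> vec_of_list ` {xs. set xs \<subseteq> UNIV \<and> length xs = n}" by blast
    qed
    have "finite (UNIV :: bit set)"
      by (rule finite_subset[of _ "{0, 1}"]) (auto intro: bit.exhaust)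
    then show "finite ((vec_of_list :: bit list \<Rightarrow> _) ` {xs. set xs \<subseteq> UNIV \<and> length xs = n})"
      by (intro finite_imageI finite_lists_length_eq)
  qed
  moreover have "{C. LCD_code n k C} \<subseteq> Pow (carrier_vec n)"
    by (auto simp: LCD_code_def binary_code_def VectorSpace.subspace_def submodule_def
        module_vec_simps)
  ultimately show ?thesis by (meson finite_Pow_iff finite_subset)
qed

lemma LCD_code_exists:
  assumes "k \<le> n"
  shows "\<exists>C. LCD_code n k C"
proof -
  interpret vec_space "TYPE(bit)" n .
  define S :: "bit vec set" where "S = unit_vec n ` {..<k}"
  have S_carr: "S \<subseteq> carrier_vec n" by (auto simp: S_def)
  have finS: "finite S" by (simp add: S_def)
  have inj: "inj_on (unit_vec n :: nat \<Rightarrow> bit vec) {..<k}"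
    using assms by (auto intro!: inj_onI)
  have cardS: "card S = k" by (simp add: S_def card_image[OF inj])
  have "S \<subseteq> set (unit_vecs n)" using assms by (auto simp: S_def unit_vecs_def)
  then have li: "lin_indpt S"
    using unit_vecs_basis subset_li_is_li unfolding basis_def by blast
  have sub: "submodule class_ring (span S) V" using span_is_submodule[OF S_carr] .
  then have subsp: "VectorSpace.subspace class_ring (span S) V"
    using span_is_subspace[OF S_carr] by simp
  interpret W: vectorspace class_ring "vs (span S)"
    by (rule subspace_is_vs[OF subsp])
  have SC: "S \<subseteq> span S" using in_own_span[OF S_carr] .
  have "W.basis S"
    unfolding W.basis_def
    using span_li_not_depend[OF SC sub] li SC by auto
  then have "W.dim = k" using W.dim_basis[OF finS] cardS by blast
  then have code: "binary_code n k (span S)"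
    using subsp by (simp add: binary_code_def)
  have zero: "x $ i = 0" if x: "x \<in> span S" and i: "i < n" "k \<le> i" for x i
  proof -
    from x obtain a where x: "x = lincomb a S"
      using finite_span[OF finS S_carr] by auto
    have "x $ i = (\<Sum>y\<in>S. a y * y $ i)"
      unfolding x by (rule lincomb_index[OF i(1) S_carr])
    also have "\<dots> = 0" using i by (intro sum.neutral) (auto simp: S_def)
    finally show ?thesis .
  qed
  have "x = 0\<^sub>v n" if x: "x \<in> span S" and d: "x \<in> dual_code n (span S)" for x
  proof
    show "dim_vec x = dim_vec (0\<^sub>v n :: bit vec)" using d by (auto simp: dual_code_eq)
    fix i assume "i < dim_vec (0\<^sub>v n :: bit vec)"
    then have i: "i < n" by simp
    have "x $ i = 0"
    proof (cases "i < k")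
      case True
      then have "unit_vec n i \<in> span S" using SC by (auto simp: S_def)
      then have "x \<bullet> unit_vec n i = 0" using d by (auto simp: dual_code_eq)
      then show ?thesis using scalar_prod_right_unit[OF i, of x] by simp
    qed (use zero[OF x i] in auto)
    then show "x $ i = 0\<^sub>v n $ i" using i by simp
  qed
  moreover have "0\<^sub>v n \<in> span S"
    using sub by (auto simp: submodule_def module_vec_simps)
  moreover have "0\<^sub>v n \<in> dual_code n (span S)"
    using span_closed[OF S_carr] by (auto simp: dual_code_eq)
  ultimately have "span S \<inter> dual_code n (span S) = {0\<^sub>v n}" by blast
  with code show ?thesis unfolding LCD_code_def by blast
qed

end

theory Submission
  imports Defs
begin

text \<open>
  Write \<open>n = 31 s + r\<close>. Both halves of the theorem come down to one finite check per residue
  \<open>r\<close>, because 31 is the length of the simplex code of dimension 5, and appending a copy of that code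
  changes the upper bound and the constructions in step.

  Upper bound. Every binary \<open>[n, k]\<close> code of minimum weight \<open>d\<close> obeys the Griesmer bound
  \<open>n \<ge> \<Sum>i<k. \<lceil>d / 2 ^ i\<rceil>\<close> (\<open>griesmer_bound\<close>). Replacing \<open>d\<close> by \<open>d + 16 s\<close>
  increases the right-hand side by exactly \<open>16 s + 8 s + 4 s + 2 s + s = 31 s\<close> when \<open>k = 5\<close>
  (\<open>griesmer_sum_shift\<close>). For each of the nine residues the Griesmer bound rules out
  one more than the asserted value of \<open>d(n, 5)\<close>.

  Lower bound. A code is given by the columns of a generator matrix \<open>G\<close>, and it is LCD if the Gram
  matrix \<open>G G\<^sup>T\<close> is invertible. Appending all 31 nonzero columns of length 5, the generator matrix
  of the simplex code, raises every nonzero weight by 16 and changes \<open>G G\<^sup>T\<close> by a matrix with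
  even entries, that is, by zero (\<open>generates_LCD_append_simplex\<close>). So one LCD code for each
  residue yields all lengths in its residue class. For the residues 3 and 4 the first length that
  is at least 5 is 34 and 35; the code of length 35 is the one of length 34 with a zero column.
  The two bounds are combined in \<open>d_LCD_periodic\<close>.

  A listed code of length \<open>n\<close> is given by \<open>n\<close> columns, written as numbers below 32. The properties
  used, the weights of its 31 nonzero words and the invertibility of its Gram matrix, are verified
  by enumerating all messages.
\<close>

section \<open>The number of codewords\<close>

text \<open>Coordinates with respect to a basis. This lets the arguments about codes speak of the
  number of words instead of the dimension.\<close>

lemma (in vectorspace) card_carrier_eq_power_dim:
  assumes "finite (carrier V)"
  shows "card (carrier V) = card (carrier K) ^ dim"
proof -
  have "fin_dim"
    unfolding fin_dim_def using assms in_own_span[of "carrier V"] span_is_subset2[of "carrier V"] by blast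
  then obtain B where B: "finite B" "basis B" using finite_basis_exists by blast
  have BC: "B \<subseteq> carrier V" using B(2) by (simp add: basis_def)
  have ex1: "\<exists>!a. a \<in> B \<rightarrow>\<^sub>E carrier K \<and> lincomb a B = v" if "v \<in> carrier V" for v
    using basis_criterion[OF B(1) BC] B(2) that by blast
  have "bij_betw (\<lambda>a. lincomb a B) (B \<rightarrow>\<^sub>E carrier K) (carrier V)"
  proof (rule bij_betwI')
    fix a b assume "a \<in> B \<rightarrow>\<^sub>E carrier K" "b \<in> B \<rightarrow>\<^sub>E carrier K"
    moreover from this have "lincomb a B \<in> carrier V" using BC by auto
    ultimately show "lincomb a B = lincomb b B \<longleftrightarrow> a = b" using ex1 by metis
  next
    fix a assume "a \<in> B \<rightarrow>\<^sub>E carrier K"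
    then show "lincomb a B \<in> carrier V" using BC by auto
  next
    fix v assume "v \<in> carrier V"
    then show "\<exists>a\<in>B \<rightarrow>\<^sub>E carrier K. v = lincomb a B" using ex1 by metis
  qed
  then have "card (carrier V) = card (B \<rightarrow>\<^sub>E carrier K)" by (simp add: bij_betw_same_card)
  also have "\<dots> = card (carrier K) ^ card B" using B(1) by (simp add: card_PiE)
  finally show ?thesis using dim_basis[OF B] by simp
qed

lemma card_UNIV_bit: "card (UNIV :: bit set) = 2"
proof -
  have "(UNIV :: bit set) = {0, 1}" by (auto intro: bit.exhaust)
  then show ?thesis by (metis card_2_iff zero_neq_one)
qed

definition support :: "bit vec \<Rightarrow> nat set" where
  "support v = {i. i < dim_vec v \<and> v $ i \<noteq> 0}"

lemma inj_on_support: "inj_on support (carrier_vec n)"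
proof (rule inj_onI)
  fix v w :: "bit vec"
  assume vw: "v \<in> carrier_vec n" "w \<in> carrier_vec n" "support v = support w"
  show "v = w"
  proof (rule eq_vecI)
    fix i assume "i < dim_vec w"
    with vw have "v $ i \<noteq> 0 \<longleftrightarrow> w $ i \<noteq> 0" by (auto simp: support_def)
    then show "v $ i = w $ i" by (cases "v $ i"; cases "w $ i") auto
  qed (use vw in auto)
qed

lemma finite_carrier_vec_bit: "finite (carrier_vec n :: bit vec set)"
proof (rule finite_imageD[OF _ inj_on_support])
  show "finite (support ` (carrier_vec n))"
    by (rule finite_subset[of _ "Pow {..<n}"]) (auto simp: support_def)
qed

lemma binary_code_iff_card:
  "binary_code n k C \<longleftrightarrow>
     VectorSpace.subspace class_ring C (module_vec TYPE(bit) n) \<and> card C = 2 ^ k"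
proof (cases "VectorSpace.subspace class_ring C (module_vec TYPE(bit) n)")
  case True
  interpret vec_space "TYPE(bit)" n .
  interpret W: vectorspace class_ring "V\<lparr>carrier := C\<rparr>" by (rule subspace_is_vs[OF True])
  have "C \<subseteq> carrier_vec n" using True by (simp add: VectorSpace.subspace_def submodule_def module_vec_simps)
  then have "finite C" using finite_carrier_vec_bit finite_subset by blast
  then have "card C = 2 ^ W.dim"
    using W.card_carrier_eq_power_dim by (simp add: card_UNIV_bit)
  then show ?thesis using True by (simp add: binary_code_def)
qed (simp add: binary_code_def)

section \<open>The Griesmer bound\<close>

text \<open>
  A binary code is a family of supports closed under symmetric difference. Delete from all words
  the support \<open>c\<close> of a nonzero word of least weight. The only words that vanish are the empty one
  and \<open>c\<close>, since a nonempty word inside \<open>c\<close> has at least the size of \<open>c\<close>; hence the number of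
  words is halved. What remains of a word \<open>x\<close> has size at least half that of \<open>c\<close>: by minimality
  of \<open>c\<close>, both \<open>x\<close> and its sum with \<open>c\<close> have at least the size of \<open>c\<close>, and the parts of
  these two words inside \<open>c\<close> are complementary. Induction on the dimension then applies to
  \<open>A - c\<close> with \<open>\<lceil>d / 2\<rceil>\<close> in place of \<open>d\<close>. The term \<open>(d + 2 ^ i - 1) div 2 ^ i\<close> is
  \<open>\<lceil>d / 2 ^ i\<rceil>\<close>.
\<close>

theorem griesmer_bound_sets:
  assumes "finite A" and "C \<subseteq> Pow A"
    and "\<And>x y. x \<in> C \<Longrightarrow> y \<in> C \<Longrightarrow> sym_diff x y \<in> C"
    and "card C = 2 ^ k"
    and "\<And>x. x \<in> C \<Longrightarrow> x \<noteq> {} \<Longrightarrow> d \<le> card x"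
  shows "(\<Sum>i<k. (d + 2 ^ i - 1) div 2 ^ i) \<le> card A"
  using assms
proof (induction k arbitrary: A C d)
  case 0
  then show ?case by simp
next
  case (Suc k)
  note closed = Suc.prems(3)
  have finC: "finite C" using Suc.prems(1,2) finite_subset by blast
  have fin: "finite x" if "x \<in> C" for x using that Suc.prems(1,2) finite_subset by blast
  have "card C > 1" using Suc.prems(4) one_less_power[of "2::nat" "Suc k"] by simp
  then obtain x where "x \<in> C" "x \<noteq> {}"
    by (metis card_le_Suc0_iff_eq finC not_le One_nat_def)
  then obtain c where c: "c \<in> C" "c \<noteq> {}"
    and least: "\<And>x. x \<in> C \<Longrightarrow> x \<noteq> {} \<Longrightarrow> card c \<le> card x"
    using ex_has_least_nat[of "\<lambda>x. x \<in> C \<and> x \<noteq> {}" x card] by blast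
  have below: "z = {} \<or> z = c" if "z \<in> C" "z \<subseteq> c" for z
    using that least card_seteq[OF fin[OF c(1)]] by blast
  let ?C = "(\<lambda>x. x - c) ` C"
  have fibre: "{y \<in> C. y - c = x - c} = {x, sym_diff x c}" if x: "x \<in> C" for x
  proof -
    have "y \<in> {x, sym_diff x c}" if y: "y \<in> C" "y - c = x - c" for y
    proof -
      have "sym_diff x y \<subseteq> c" using y by blast
      with below closed[OF x y(1)] have "sym_diff x y = {} \<or> sym_diff x y = c" by blast
      then show ?thesis by blast
    qed
    then show ?thesis using x closed[OF x c(1)] by blast
  qed
  \<comment> \<open>Counting \<open>C\<close> along the two-element fibres of \<open>x \<mapsto> x - c\<close>.\<close>
  have "card C = (\<Sum>x\<in>C. 1)" by simp
  also have "\<dots> = (\<Sum>z\<in>?C. card {y \<in> C. y - c = z})"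
    using sum.image_gen[OF finC, of "\<lambda>_. 1::nat" "\<lambda>x. x - c"] by simp
  also have "\<dots> = (\<Sum>z\<in>?C. 2)"
  proof (rule sum.cong)
    fix z assume "z \<in> ?C"
    then obtain x where x: "x \<in> C" "z = x - c" by blast
    have "x \<noteq> sym_diff x c" using c(2) by blast
    then show "card {y \<in> C. y - c = z} = 2" unfolding x(2) fibre[OF x(1)] by simp
  qed simp
  finally have "2 ^ Suc k = card ?C * 2" unfolding Suc.prems(4) by simp
  then have cardC': "card ?C = 2 ^ k" by simp
  have dc: "d \<le> card c" using Suc.prems(5) c by blast
  have half: "(d + 1) div 2 \<le> card z" if z: "z \<in> ?C" "z \<noteq> {}" for z
  proof -
    from z obtain x where x: "x \<in> C" "z = x - c" "x - c \<noteq> {}" by blast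
    have "card c \<le> card (sym_diff x c)" "card c \<le> card x"
      using x closed[OF x(1) c(1)] by (blast intro: least)+
    moreover have "card (sym_diff x c) = card (x - c) + card (c - x)"
      using fin x(1) c(1) by (subst card_Un_disjoint) auto
    moreover have "card x = card (x \<inter> c) + card (x - c)" "card c = card (x \<inter> c) + card (c - x)"
      using fin[OF x(1)] fin[OF c(1)] by (metis card_Int_Diff Int_commute)+
    ultimately show ?thesis unfolding x(2) using dc by linarith
  qed
  have "(\<Sum>i<k. ((d + 1) div 2 + 2 ^ i - 1) div 2 ^ i) \<le> card (A - c)"
  proof (rule Suc.IH)
    fix x y assume "x \<in> ?C" "y \<in> ?C"
    then obtain x' y' where "x' \<in> C" "y' \<in> C" "x = x' - c" "y = y' - c" by blast
    moreover from this have "sym_diff x y = sym_diff x' y' - c" by blast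
    ultimately show "sym_diff x y \<in> ?C" using closed by blast
  qed (use Suc.prems(1,2) cardC' half in auto)
  \<comment> \<open>Iterated rounding up: \<open>\<lceil>\<lceil>d / 2\<rceil> / 2 ^ i\<rceil> = \<lceil>d / 2 ^ (i + 1)\<rceil>\<close>.\<close>
  moreover have "((d + 1) div 2 + 2 ^ i - 1) div 2 ^ i = (d + 2 ^ Suc i - 1) div 2 ^ Suc i" for i
  proof -
    have "d + 2 ^ Suc i - 1 = (d + 1) + (2 ^ i - 1) * 2"
      using one_le_power[of "2::nat" i] unfolding power_Suc by linarith
    then have "(d + 2 ^ Suc i - 1) div 2 = (d + 1) div 2 + 2 ^ i - 1"
      using one_le_power[of "2::nat" i] by (simp only: div_mult_self1) simp
    then show ?thesis by (simp add: div_mult2_eq)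
  qed
  moreover have "card (A - c) + card c = card A"
    using c(1) Suc.prems(1,2) by (metis PowD card_Diff_subset card_mono fin le_add_diff_inverse2 subsetD)
  ultimately show ?case using dc by (simp del: sum.lessThan_Suc add: sum.lessThan_Suc_shift)
qed

theorem griesmer_bound:
  assumes C: "binary_code n k C"
  shows "(\<Sum>i<k. (min_weight n C + 2 ^ i - 1) div 2 ^ i) \<le> n"
proof -
  interpret vec_space "TYPE(bit)" n .
  have sub: "C \<subseteq> carrier_vec n" and add: "\<And>x y. x \<in> C \<Longrightarrow> y \<in> C \<Longrightarrow> x + y \<in> C"
    using C by (auto simp: binary_code_def VectorSpace.subspace_def submodule_def module_vec_simps)
  have finC: "finite C" using sub finite_carrier_vec_bit finite_subset by blast
  have symm: "sym_diff (support x) (support y) = support (x + y)" if "x \<in> C" "y \<in> C" for x y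
  proof -
    have "dim_vec x = n" "dim_vec y = n" using that sub by auto
    moreover have "a + b = 1 \<longleftrightarrow> (a = 1) \<noteq> (b = 1)" for a b :: bit
      by (cases a; cases b) auto
    ultimately show ?thesis unfolding support_def by auto
  qed
  have "(\<Sum>i<k. (min_weight n C + 2 ^ i - 1) div 2 ^ i) \<le> card {..<n}"
  proof (rule griesmer_bound_sets)
    show "support ` C \<subseteq> Pow {..<n}" using sub by (auto simp: support_def)
    show "card (support ` C) = 2 ^ k"
      using C inj_on_subset[OF inj_on_support sub] by (simp add: binary_code_iff_card card_image)
    show "sym_diff x y \<in> support ` C" if "x \<in> support ` C" "y \<in> support ` C" for x y
      using that add symm by auto
    show "min_weight n C \<le> card x" if "x \<in> support ` C" "x \<noteq> {}" for x
    proof -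
      from that obtain v where v: "v \<in> C" "x = support v" by blast
      with that(2) have "v \<noteq> 0\<^sub>v n" by (auto simp: support_def)
      then show ?thesis unfolding min_weight_def v(2) support_def weight_def[symmetric]
        using v(1) finC by (intro Min_le) auto
    qed
  qed simp
  then show ?thesis by simp
qed

lemma griesmer_bound_d_LCD:
  assumes "k \<le> n"
  shows "(\<Sum>i<k. (d_LCD n k + 2 ^ i - 1) div 2 ^ i) \<le> n"
proof -
  have "d_LCD n k \<in> min_weight n ` {C. LCD_code n k C}"
    unfolding d_LCD_def using LCD_code_exists[OF assms] by (intro Max_in) (auto simp: finite_LCD_codes)
  then show ?thesis using griesmer_bound by (auto simp: LCD_code_def)
qed

section \<open>LCD codes from lists of columns\<close>

text \<open>The inner product over the field with two elements of the vector \<open>u\<close> with the vector of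
  binary digits of \<open>m\<close>, least significant digit first. Numbers keep the columns of a generator
  matrix short, and the columns of the simplex code become an interval.\<close>

fun parity_product :: "bool list \<Rightarrow> nat \<Rightarrow> bool" where
  "parity_product [] m = False"
| "parity_product (a # u) m = ((a \<and> odd m) \<noteq> parity_product u (m div 2))"

text \<open>The product of the message \<open>u\<close> with the generator matrix whose columns are \<open>cs\<close>.\<close>

definition codeword :: "nat list \<Rightarrow> bool list \<Rightarrow> bit vec" where
  "codeword cs u = vec (length cs) (\<lambda>i. of_bool (parity_product u (cs ! i)))"

text \<open>The second condition says that every nonzero message has a codeword that is not orthogonal
  to the code, which is the invertibility of the Gram matrix in a form that can be tested directly.
  It also makes the encoding of messages injective.\<close>

definition generates_LCD :: "nat \<Rightarrow> nat \<Rightarrow> nat list \<Rightarrow> bool" where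
  "generates_LCD k d cs \<longleftrightarrow>
     (\<forall>u. length u = k \<and> True \<in> set u \<longrightarrow>
        d \<le> length (filter (parity_product u) cs) \<and>
        (\<exists>v. length v = k \<and>
          odd (length (filter (\<lambda>m. parity_product u m \<and> parity_product v m) cs))))"

lemma parity_product_xor:
  "length u = length v \<Longrightarrow>
   parity_product (map2 (\<noteq>) u v) m \<longleftrightarrow> parity_product u m \<noteq> parity_product v m"
  by (induction u v arbitrary: m rule: list_induct2) auto

lemma parity_product_zero: "True \<notin> set u \<Longrightarrow> \<not> parity_product u m"
  by (induction u arbitrary: m) auto

lemma weight_codeword: "weight (codeword cs u) = length (filter (parity_product u) cs)"
  by (auto simp: weight_def codeword_def length_filter_conv_card intro!: arg_cong[of _ _ card])

text \<open>Inner products of codewords are parities of column counts, and such counts add up when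
  lists of columns are appended.\<close>

lemma scalar_prod_codeword:
  "codeword cs u \<bullet> codeword cs v =
     of_bool (odd (length (filter (\<lambda>m. parity_product u m \<and> parity_product v m) cs)))"
proof -
  let ?P = "\<lambda>i. parity_product u (cs ! i) \<and> parity_product v (cs ! i)"
  have nat: "(of_nat j :: bit) = of_bool (odd j)" for j by (induction j) auto
  have "codeword cs u \<bullet> codeword cs v = (\<Sum>i<length cs. of_bool (?P i))"
    unfolding scalar_prod_def codeword_def
    by (intro sum.cong) (auto simp: lessThan_atLeast0)
  also have "\<dots> = of_nat (card ({..<length cs} \<inter> {i. ?P i}))" by (subst sum_of_bool_eq) auto
  also have "{..<length cs} \<inter> {i. ?P i} = {i. i < length cs \<and> ?P i}" by auto
  finally show ?thesis by (simp add: nat length_filter_conv_card)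
qed

lemma LCD_code_of_columns:
  assumes "generates_LCD k d cs" and "0 < k"
  shows "\<exists>C. LCD_code (length cs) k C \<and> d \<le> min_weight (length cs) C"
proof -
  define n where "n = length cs"
  interpret vec_space "TYPE(bit)" n .
  define M where "M = {u :: bool list. length u = k}"
  define C where "C = codeword cs ` M"
  have carr: "codeword cs u \<in> carrier_vec n" for u by (simp add: codeword_def n_def)
  have zero: "codeword cs u = 0\<^sub>v n" if "True \<notin> set u" for u
    using parity_product_zero[OF that] by (auto simp: codeword_def n_def)
  have partner: "\<exists>v\<in>M. codeword cs u \<bullet> codeword cs v \<noteq> 0" if "u \<in> M" "True \<in> set u" for u
    using assms(1) that by (fastforce simp: generates_LCD_def M_def scalar_prod_codeword)
  have nonzero: "codeword cs u \<noteq> 0\<^sub>v n" if "u \<in> M" "True \<in> set u" for u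
    using partner[OF that] carr by fastforce
  have add: "codeword cs u + codeword cs v = codeword cs (map2 (\<noteq>) u v)"
    if "u \<in> M" "v \<in> M" for u v
    using that parity_product_xor[of u v] by (auto simp: codeword_def M_def)
  have M_xor: "map2 (\<noteq>) u v \<in> M" if "u \<in> M" "v \<in> M" for u v using that by (simp add: M_def)
  have zeroC: "0\<^sub>v n \<in> C"
    unfolding C_def by (rule image_eqI[of _ _ "replicate k False"]) (auto simp: zero M_def)
  have inj: "inj_on (codeword cs) M"
  proof (rule inj_onI)
    fix u v assume uv: "u \<in> M" "v \<in> M" "codeword cs u = codeword cs v"
    have "codeword cs (map2 (\<noteq>) u v) = 0\<^sub>v n"
      unfolding add[OF uv(1,2), symmetric] uv(3) by (auto simp: codeword_def n_def)
    then have "True \<notin> set (map2 (\<noteq>) u v)" using nonzero M_xor uv(1,2) by blast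
    then show "u = v" using uv(1,2) by (auto simp: M_def set_zip intro!: nth_equalityI)
  qed
  have "card M = 2 ^ k"
    using card_lists_length_eq[of "UNIV :: bool set" k] by (simp add: M_def)
  then have cardC: "card C = 2 ^ k" unfolding C_def by (simp add: card_image[OF inj])
  have "submodule class_ring C V"
  proof
    show "C \<subseteq> carrier V" using carr by (auto simp: C_def)
    show "v \<oplus>\<^bsub>V\<^esub> w \<in> C" if "v \<in> C" "w \<in> C" for v w
      using that add M_xor by (auto simp: C_def)
    show "c \<odot>\<^bsub>V\<^esub> v \<in> C" if "v \<in> C" for c v
    proof (cases "c = 0")
      case True
      then have "c \<odot>\<^bsub>V\<^esub> v = 0\<^sub>v n" using that carr by (auto simp: C_def)
      then show ?thesis using zeroC by simp
    qed (use that in simp)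
  qed (use zeroC in simp)
  then have "binary_code n k C"
    using cardC vec_vs unfolding binary_code_iff_card VectorSpace.subspace_def by blast
  moreover have "C \<inter> dual_code n C = {0\<^sub>v n}"
  proof -
    have "x = 0\<^sub>v n" if "x \<in> C" "x \<in> dual_code n C" for x
      using that partner zero by (fastforce simp: C_def dual_code_eq)
    moreover have "0\<^sub>v n \<in> dual_code n C" using carr by (auto simp: dual_code_eq C_def)
    ultimately show ?thesis using zeroC by blast
  qed
  moreover have "d \<le> min_weight n C"
  proof -
    have "codeword cs (replicate k True) \<in> C - {0\<^sub>v n}"
      using nonzero[of "replicate k True"] assms(2) by (auto simp: C_def M_def)
    moreover have "finite C" using cardC by (intro card_ge_0_finite) simp
    moreover have "d \<le> weight x" if "x \<in> C - {0\<^sub>v n}" for x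
    proof -
      from that obtain u where "x = codeword cs u" "u \<in> M" "True \<in> set u"
        using zero by (auto simp: C_def)
      then show ?thesis using assms(1) by (simp add: weight_codeword generates_LCD_def M_def)
    qed
    ultimately show ?thesis unfolding min_weight_def by (subst Min_ge_iff) auto
  qed
  ultimately show ?thesis unfolding n_def LCD_code_def by blast
qed

lemma d_LCD_ge_of_columns:
  assumes "generates_LCD k d cs" and "0 < k"
  shows "d \<le> d_LCD (length cs) k"
proof -
  obtain C where C: "LCD_code (length cs) k C" "d \<le> min_weight (length cs) C"
    using LCD_code_of_columns[OF assms] by blast
  then have "min_weight (length cs) C \<le> d_LCD (length cs) k"
    unfolding d_LCD_def by (intro Max_ge) (auto simp: finite_LCD_codes)
  with C(2) show ?thesis by simp
qed

text \<open>Column numbers are expanded into digits once, so that enumerating the messages involves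
  Boolean operations only; repeated halving of unary numbers would be far too slow.\<close>

fun digits :: "nat \<Rightarrow> nat \<Rightarrow> bool list" where
  "digits 0 m = []"
| "digits (Suc k) m = odd m # digits k (m div 2)"

fun list_product :: "bool list \<Rightarrow> bool list \<Rightarrow> bool" where
  "list_product (a # u) (b # v) = ((a \<and> b) \<noteq> list_product u v)"
| "list_product _ _ = False"

lemma list_product_digits: "length u = k \<Longrightarrow> list_product u (digits k m) = parity_product u m"
  by (induction u arbitrary: k m) auto

lemma generates_LCD_enumerated:
  "generates_LCD k d cs \<longleftrightarrow>
     (let us = List.n_lists k [False, True]; bs = map (digits k) cs in
      \<forall>u\<in>set us. True \<in> set u \<longrightarrow>
        d \<le> length (filter (list_product u) bs) \<and>
        (\<exists>v\<in>set us. odd (length (filter (\<lambda>b. list_product u b \<and> list_product v b) bs))))"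
proof -
  have us: "set (List.n_lists k [False, True]) = {u. length u = k}"
    by (auto simp: set_n_lists)
  show ?thesis
    unfolding generates_LCD_def Let_def us by (auto simp: filter_map o_def list_product_digits)
qed

section \<open>Appending a simplex code\<close>

text \<open>Splitting a number into its last binary digit and the rest matches the recursion of
  \<open>parity_product\<close>.\<close>

lemma card_less_double:
  "card {m. m < 2 * N \<and> P m} = card {m. m < N \<and> P (2 * m)} + card {m. m < N \<and> P (2 * m + 1)}"
  for N :: nat
proof -
  let ?E = "{m. m < N \<and> P (2 * m)}" and ?O = "{m. m < N \<and> P (2 * m + 1)}"
  have "{m. m < 2 * N \<and> P m} = (\<lambda>m. 2 * m) ` ?E \<union> (\<lambda>m. 2 * m + 1) ` ?O"
  proof (intro equalityI subsetI)
    fix m assume "m \<in> {m. m < 2 * N \<and> P m}"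
    then show "m \<in> (\<lambda>m. 2 * m) ` ?E \<union> (\<lambda>m. 2 * m + 1) ` ?O"
      by (cases "even m") (auto elim!: evenE oddE)
  qed auto
  moreover have "(\<lambda>m. 2 * m) ` ?E \<inter> (\<lambda>m. 2 * m + 1) ` ?O = {}" by (auto; presburger)
  ultimately show ?thesis
    by (simp add: card_Un_disjoint card_image inj_on_def)
qed

lemma card_less_not: "card {m. m < N \<and> \<not> P m} = N - card {m. m < N \<and> P m}" for N :: nat
proof -
  have "{m. m < N \<and> \<not> P m} = {..<N} - {m. m < N \<and> P m}" by auto
  then show ?thesis by (simp add: card_Diff_subset subset_eq)
qed

text \<open>If the first entry of \<open>u\<close> is 1, flipping the last digit of \<open>m\<close> flips the product, so
  exactly half of all \<open>m\<close> count; otherwise that digit is irrelevant and the count doubles.\<close>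

lemma simplex_weight:
  "card {m. m < 2 ^ length u \<and> parity_product u m} =
     (if True \<in> set u then 2 ^ (length u - 1) else 0)"
proof (induction u)
  case (Cons a u)
  let ?c = "card {m. m < 2 ^ length u \<and> parity_product u m}"
  have "?c \<le> card {..<2 ^ length u :: nat}" by (intro card_mono) auto
  then have "card {m. m < 2 ^ length (a # u) \<and> parity_product (a # u) m} =
      (if a then 2 ^ length u else 2 * ?c)"
    by (simp add: card_less_double card_less_not)
  then show ?case using Cons.IH by (cases u) auto
qed simp

text \<open>Any two words of the simplex code of dimension at least 3 are orthogonal (and each is
  orthogonal to itself). After removing the first entries, all counts of a single
  message and of its complement are even, as they are \<open>0\<close> or powers of two with positive
  exponent. The count for a pair of messages is twice some count or differs from such a single
  count by an even number.\<close>

lemma simplex_scalar_prod: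
  assumes "length u = k" "length v = k" "3 \<le> k"
  shows "even (card {m. m < 2 ^ k \<and> parity_product u m \<and> parity_product v m})"
proof -
  obtain a u' b v' where uv: "u = a # u'" "v = b # v'" using assms by (cases u; cases v) auto
  define l where "l = length u'"
  have l: "length u' = l" "length v' = l" "k = Suc l" "2 \<le> l" using assms uv by (auto simp: l_def)
  let ?P = "parity_product u'" and ?Q = "parity_product v'"
  have even: "even (card {m. m < 2 ^ l \<and> ?P m})" "even (card {m. m < 2 ^ l \<and> ?Q m})"
    using simplex_weight[of u'] simplex_weight[of v'] l by auto
  have split: "card {m. m < 2 ^ l \<and> R m \<and> S m} + card {m. m < 2 ^ l \<and> R m \<and> \<not> S m} =
      card {m. m < 2 ^ l \<and> R m}" for R S :: "nat \<Rightarrow> bool"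
    by (subst card_Un_disjoint[symmetric]) (auto intro!: arg_cong[of _ _ card])
  have "even (2 ^ l :: nat)" using l by simp
  then have even': "even (card {m. m < 2 ^ l \<and> \<not> ?P m})"
    using even(1) by (simp add: card_less_not)
  have QP: "{m. m < 2 ^ l \<and> ?Q m \<and> ?P m} = {m. m < 2 ^ l \<and> ?P m \<and> ?Q m}"
    "{m. m < 2 ^ l \<and> ?Q m \<and> \<not> ?P m} = {m. m < 2 ^ l \<and> \<not> ?P m \<and> ?Q m}" by auto
  note splits = split[of ?P ?Q] split[of "\<lambda>m. \<not> ?P m" ?Q] split[of ?Q ?P, unfolded QP]
  have TF: "even (card {m. m < 2 ^ l \<and> ?P m \<and> ?Q m} + card {m. m < 2 ^ l \<and> \<not> ?P m \<and> ?Q m})"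
    using even(2) splits(3) by simp
  have FT: "even (card {m. m < 2 ^ l \<and> ?P m \<and> ?Q m} + card {m. m < 2 ^ l \<and> ?P m \<and> \<not> ?Q m})"
    using even(1) splits(1) by simp
  have TT: "even (card {m. m < 2 ^ l \<and> ?P m \<and> ?Q m} + card {m. m < 2 ^ l \<and> \<not> ?P m \<and> \<not> ?Q m})"
    using TF even' splits(2) by presburger
  show ?thesis
    using TF FT TT unfolding uv l(3) power_Suc card_less_double by (cases a; cases b) simp_all
qed

text \<open>A witness for non-orthogonality stays one, because the simplex code contributes an even
  number to every inner product.\<close>

lemma generates_LCD_append_simplex:
  assumes "generates_LCD k d cs" "3 \<le> k"
  shows "generates_LCD k (d + 2 ^ (k - 1)) (cs @ [1..<2 ^ k])"
proof -
  have count: "length (filter P [1..<2 ^ k]) = card {m. m < 2 ^ k \<and> P m}" if "\<not> P 0" for P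
  proof -
    have "length (filter P [1..<2 ^ k]) = card (set (filter P [1..<2 ^ k]))"
      by (rule distinct_card[symmetric]) simp
    also have "set (filter P [1..<2 ^ k]) = {m. m < 2 ^ k \<and> P m}"
      using that by (auto intro: Suc_leI gr0I)
    finally show ?thesis .
  qed
  have zero: "\<not> parity_product u 0" for u by (induction u) auto
  show ?thesis
    unfolding generates_LCD_def
  proof (intro allI impI, elim conjE)
    fix u assume u: "length u = k" "True \<in> set u"
    then obtain v where v: "length v = k" "d \<le> length (filter (parity_product u) cs)"
      "odd (length (filter (\<lambda>m. parity_product u m \<and> parity_product v m) cs))"
      using assms(1) unfolding generates_LCD_def by blast
    have "length (filter (parity_product u) [1..<2 ^ k]) = 2 ^ (k - 1)"
      using simplex_weight[of u] u by (subst count) (simp_all add: zero)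
    moreover have "even (length (filter (\<lambda>m. parity_product u m \<and> parity_product v m) [1..<2 ^ k]))"
      using simplex_scalar_prod[OF u(1) v(1) assms(2)] by (subst count) (simp_all add: zero)
    ultimately show "d + 2 ^ (k - 1) \<le> length (filter (parity_product u) (cs @ [1..<2 ^ k])) \<and>
      (\<exists>v. length v = k \<and>
        odd (length (filter (\<lambda>m. parity_product u m \<and> parity_product v m) (cs @ [1..<2 ^ k]))))"
      using v by (intro conjI exI[of _ v]) simp_all
  qed
qed

lemma generates_LCD_append_simplexes:
  assumes "generates_LCD k d cs" "3 \<le> k"
  shows "\<exists>cs'. length cs' = length cs + (2 ^ k - 1) * s \<and> generates_LCD k (d + 2 ^ (k - 1) * s) cs'"
proof (induction s)
  case 0
  then show ?case using assms(1) by auto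
next
  case (Suc s)
  then obtain cs' where "length cs' = length cs + (2 ^ k - 1) * s"
    "generates_LCD k (d + 2 ^ (k - 1) * s) cs'" by blast
  then show ?case using generates_LCD_append_simplex[OF _ assms(2)]
    by (intro exI[of _ "cs' @ [1..<2 ^ k]"]) (fastforce simp: add_ac)
qed

lemma griesmer_sum_shift:
  "(\<Sum>i<k. (d + 2 ^ (k - 1) * s + 2 ^ i - 1) div 2 ^ i) =
     (\<Sum>i<k. (d + 2 ^ i - 1) div 2 ^ i) + (2 ^ k - 1) * (s :: nat)"
proof -
  have "(d + 2 ^ (k - 1) * s + 2 ^ i - 1) div 2 ^ i =
      (d + 2 ^ i - 1) div 2 ^ i + 2 ^ (k - Suc i) * s" if "i < k" for i
  proof -
    have "2 ^ (k - 1) = (2 ^ i * 2 ^ (k - Suc i) :: nat)"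
      using that by (simp flip: power_add)
    then have "d + 2 ^ (k - 1) * s + 2 ^ i - 1 = (d + 2 ^ i - 1) + 2 ^ i * (2 ^ (k - Suc i) * s)"
      using one_le_power[of "2::nat" i] by (simp only: mult.assoc) linarith
    then show ?thesis by simp
  qed
  then have "(\<Sum>i<k. (d + 2 ^ (k - 1) * s + 2 ^ i - 1) div 2 ^ i) =
      (\<Sum>i<k. (d + 2 ^ i - 1) div 2 ^ i) + (\<Sum>i<k. 2 ^ (k - Suc i)) * s"
    by (simp add: sum.distrib sum_distrib_right)
  moreover have "(\<Sum>i<k. 2 ^ (k - Suc i)) = (2 ^ k - 1 :: nat)"
    using sum.nat_diff_reindex[of "\<lambda>i. 2 ^ i :: nat" k] by (simp add: mask_eq_sum_exp_nat lessThan_def)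
  ultimately show ?thesis by simp
qed

text \<open>Once a single LCD code meets the Griesmer bound, its extensions by simplex codes do too,
  because the bound moves at the same rate as the length.\<close>

theorem d_LCD_periodic:
  assumes "generates_LCD k d cs" and k: "3 \<le> k" "k \<le> length cs"
    and griesmer: "length cs < (\<Sum>i<k. (d + 1 + 2 ^ i - 1) div 2 ^ i)"
  shows "d_LCD (length cs + (2 ^ k - 1) * s) k = d + 2 ^ (k - 1) * s"
proof (rule antisym)
  let ?n = "length cs + (2 ^ k - 1) * s"
  show "d_LCD ?n k \<le> d + 2 ^ (k - 1) * s"
  proof (rule ccontr)
    assume "\<not> ?thesis"
    then have le: "d + 1 + 2 ^ (k - 1) * s \<le> d_LCD ?n k" by simp
    have "?n < (\<Sum>i<k. (d + 1 + 2 ^ (k - 1) * s + 2 ^ i - 1) div 2 ^ i)"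
      unfolding griesmer_sum_shift using griesmer by simp
    also have "\<dots> \<le> (\<Sum>i<k. (d_LCD ?n k + 2 ^ i - 1) div 2 ^ i)"
      using le by (intro sum_mono div_le_mono diff_le_mono add_right_mono)
    also have "\<dots> \<le> ?n" using k(2) by (intro griesmer_bound_d_LCD) simp
    finally show False by simp
  qed
  obtain cs' where "length cs' = ?n" "generates_LCD k (d + 2 ^ (k - 1) * s) cs'"
    using generates_LCD_append_simplexes[OF assms(1) k(1)] by blast
  then show "d + 2 ^ (k - 1) * s \<le> d_LCD ?n k"
    using d_LCD_ge_of_columns k(1) by fastforce
qed

section \<open>Dimension five\<close>

text \<open>In the last assumption, \<open>(d + 2 ^ i) div 2 ^ i\<close> is \<open>\<lceil>(d + 1) / 2 ^ i\<rceil>\<close>: no code of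
  length \<open>n\<close> and minimum weight \<open>d + 1\<close> satisfies the Griesmer bound.\<close>

lemma d_LCD_5_periodic:
  assumes "generates_LCD 5 d cs" and "length cs = n" and "5 \<le> n"
    and "n < (d + 1) + (d + 2) div 2 + (d + 4) div 4 + (d + 8) div 8 + (d + 16) div 16"
  shows "d_LCD (n + 31 * s) 5 = d + 16 * s"
proof -
  have "{..<5} = {0, 1, 2, 3, 4 :: nat}" by auto
  then have "length cs < (\<Sum>i<5. (d + 1 + 2 ^ i - 1) div 2 ^ i)"
    using assms(2,4) by simp
  then show ?thesis using d_LCD_periodic[OF assms(1), of s] assms(2,3) by simp
qed

text \<open>The column lists below are not canonical: every list extends the five unit vectors by
  columns found in a computer search, except that length 35 is length 34 with a zero column.\<close>

lemma d_LCD_5_length_5: "d_LCD (5 + 31 * s) 5 = 1 + 16 * s"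
proof (rule d_LCD_5_periodic)
  show "generates_LCD 5 1
     [1, 2, 4, 8, 16]"
    unfolding generates_LCD_enumerated by code_simp
qed simp_all

lemma d_LCD_5_length_7: "d_LCD (7 + 31 * s) 5 = 2 + 16 * s"
proof (rule d_LCD_5_periodic)
  show "generates_LCD 5 2
     [1, 2, 4, 8, 16, 22, 31]"
    unfolding generates_LCD_enumerated by code_simp
qed simp_all

lemma d_LCD_5_length_11: "d_LCD (11 + 31 * s) 5 = 4 + 16 * s"
proof (rule d_LCD_5_periodic)
  show "generates_LCD 5 4
     [1, 2, 3, 4, 5, 8, 14, 16, 19, 25, 28]"
    unfolding generates_LCD_enumerated by code_simp
qed simp_all

lemma d_LCD_5_length_19: "d_LCD (19 + 31 * s) 5 = 8 + 16 * s"
proof (rule d_LCD_5_periodic)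
  show "generates_LCD 5 8
     [1, 2, 3, 4, 6, 7, 8, 11, 12, 13, 14, 16, 19, 19, 21, 25, 26, 27, 28]"
    unfolding generates_LCD_enumerated by code_simp
qed simp_all

lemma d_LCD_5_length_20: "d_LCD (20 + 31 * s) 5 = 9 + 16 * s"
proof (rule d_LCD_5_periodic)
  show "generates_LCD 5 9
     [1, 2, 3, 4, 5, 7, 8, 10, 11, 13, 14, 16, 17, 19, 22, 25, 26, 28, 29, 31]"
    unfolding generates_LCD_enumerated by code_simp
qed simp_all

lemma d_LCD_5_length_22: "d_LCD (22 + 31 * s) 5 = 10 + 16 * s"
proof (rule d_LCD_5_periodic)
  show "generates_LCD 5 10
     [1, 2, 3, 4, 5, 6, 8, 10, 12, 13, 15, 16, 17, 18, 21, 23, 25, 26, 27, 28, 28, 30]"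
    unfolding generates_LCD_enumerated by code_simp
qed simp_all

lemma d_LCD_5_length_26: "d_LCD (26 + 31 * s) 5 = 12 + 16 * s"
proof (rule d_LCD_5_periodic)
  show "generates_LCD 5 12
     [1, 2, 3, 4, 4, 5, 6, 7, 8, 9, 10, 11, 13, 14, 16, 17, 18, 19, 20, 21, 24, 26, 28, 29,
      30, 31]"
    unfolding generates_LCD_enumerated by code_simp
qed simp_all

lemma d_LCD_5_length_34: "d_LCD (34 + 31 * s) 5 = 16 + 16 * s"
proof (rule d_LCD_5_periodic)
  show "generates_LCD 5 16
     [1, 2, 2, 3, 4, 5, 6, 7, 8, 8, 9, 10, 11, 12, 12, 13, 15, 16, 16, 17, 18, 19, 20, 21, 22,
      23, 25, 26, 27, 28, 29, 30, 31, 31]"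
    unfolding generates_LCD_enumerated by code_simp
qed simp_all

lemma d_LCD_5_length_35: "d_LCD (35 + 31 * s) 5 = 16 + 16 * s"
proof (rule d_LCD_5_periodic)
  show "generates_LCD 5 16
     [0, 1, 2, 2, 3, 4, 5, 6, 7, 8, 8, 9, 10, 11, 12, 12, 13, 15, 16, 16, 17, 18, 19, 20, 21,
      22, 23, 25, 26, 27, 28, 29, 30, 31, 31]"
    unfolding generates_LCD_enumerated by code_simp
qed simp_all

theorem theorem2:
  fixes n :: nat
  assumes "n \<ge> 5"
  shows "(n mod 31 \<in> {3, 5, 7, 11, 19, 20, 22, 26} \<longrightarrow>
            int (d_LCD n 5) = \<lfloor>16 * real n / 31\<rfloor> - 1) \<and>
         (n mod 31 = 4 \<longrightarrow>
            int (d_LCD n 5) = \<lfloor>16 * real n / 31\<rfloor> - 2)"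
proof -
  have period: "d_LCD (r + 31 * s) 5 = d + 16 * s"
    if "(r, d) \<in> {(5, 1), (7, 2), (11, 4), (19, 8), (20, 9), (22, 10), (26, 12), (34, 16), (35, 16)}"
    for r d s :: nat
    using that by (elim insertE emptyE Pair_inject)
      (simp_all only: d_LCD_5_length_5 d_LCD_5_length_7 d_LCD_5_length_11 d_LCD_5_length_19
        d_LCD_5_length_20 d_LCD_5_length_22 d_LCD_5_length_26 d_LCD_5_length_34 d_LCD_5_length_35)
  have floor: "\<lfloor>16 * real n / 31\<rfloor> = int (16 * n div 31)"
    using floor_divide_of_nat_eq[of "16 * n" 31, where ?'a = real] by simp
  have small: "int (d_LCD n 5) = \<lfloor>16 * real n / 31\<rfloor> - 1"
    if "n mod 31 = r" "(r, d) \<in> {(5, 1), (7, 2), (11, 4), (19, 8), (20, 9), (22, 10), (26, 12)}"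
    for r d :: nat
  proof -
    have n: "n = r + 31 * (n div 31)" using that(1) by presburger
    have "d_LCD n 5 = d + 16 * (n div 31)" by (subst n, rule period) (use that(2) in auto)
    moreover have "16 * n div 31 = d + 1 + 16 * (n div 31)"
      using that(2) by (subst n) auto
    ultimately show ?thesis unfolding floor by simp
  qed
  \<comment> \<open>Here \<open>n \<ge> 5\<close> excludes \<open>n = 3\<close> and \<open>n = 4\<close>, so the residues 3 and 4 start at the lengths
    34 and 35, where the deviation \<open>r - 33\<close> from the floor is 1 and 2.\<close>
  have large: "int (d_LCD n 5) = int (16 * n div 31) - (int r - 33)"
    if "n mod 31 = r - 31" "r \<in> {34, 35}" for r
  proof -
    define s where "s = n div 31 - 1"
    have "n div 31 \<noteq> 0" using that assms by (auto simp: div_eq_0_iff)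
    then have n: "n = r + 31 * s"
      using that div_mult_mod_eq[of n 31] unfolding s_def by auto
    have "d_LCD n 5 = 16 + 16 * s" by (subst n, rule period) (use that(2) in auto)
    moreover have "16 * n div 31 = r - 33 + (16 + 16 * s)" using that(2) n by auto
    ultimately show ?thesis using that(2) by auto
  qed
  show ?thesis
    using small[of 5 1] small[of 7 2] small[of 11 4] small[of 19 8] small[of 20 9] small[of 22 10]
      small[of 26 12] large[of 34] large[of 35] unfolding floor by auto
qed

end
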